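(* Let $p,q\ge 1$ and $n\ge 2$ be integers. Let $K_{p,q}$ be the complete bipartite graph with parts $P$ ($|P|=p$) and $Q$ ($|Q|=q$), and let $K_{p, q}\circ_{1}K_n$ be the graph obtained by identifying a vertex $a\in P$ with a vertex of the complete graph $K_n$; let $N$ denote the set of the other $n-1$ vertices of $K_n$. Then the resistance distances in $K_{p, q}\circ_{1}K_n$ are: $r(a,x)=\frac{2}{q}$ for $x\in P\setminus\{a\}$; $r(a,y)=\frac{p+q-1}{pq}$ for $y\in Q$; $r(a,z)=\frac{2}{n}$ for $z\in N$; $r(x,x')=\frac{2}{q}$ for distinct $x,x'\in P\setminus\{a\}$; $r(x,y)=\frac{p+q-1}{pq}$ for $x\in P\setminus\{a\}$, $y\in Q$; $r(x,z)=\frac{2(q+n)}{qn}$ for $x\in P\setminus\{a\}$, $z\in N$; $r(y,y')=\frac{2}{p}$ for distinct $y,y'\in Q$; $r(y,z)=\frac{q(n+2p)+n(p-1)}{npq}$ for $y\in Q$, $z\in N$; $r(z,z')=\frac{2}{n}$ for distinct $z,z'\in N$.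
   Context: The resistance distance between vertices of a connected graph is the effective resistance between them when every edge is a resistor of $1\Omega$; equivalently $r_{ij}=l^{\#}_{ii}+l^{\#}_{jj}-2l^{\#}_{ij}$ with $L^{\#}$ the group inverse of the Laplacian $L=D-A$. *)

theory Defs
  imports "HOL-Analysis.Analysis"
begin

text \<open>
  A finite simple graph has a finite type as its vertex set and is given by its adjacency
  relation, a symmetric and irreflexive set of ordered pairs: the edge between \<open>u\<close> and \<open>v\<close>
  is represented by both \<open>(u, v)\<close> and \<open>(v, u)\<close>.
\<close>

definition adjacency_matrix :: "('v::finite) rel \<Rightarrow> real^'v^'v" where
  "adjacency_matrix E = (\<chi> i j. if (i, j) \<in> E then 1 else 0)"

definition degree_matrix :: "('v::finite) rel \<Rightarrow> real^'v^'v" where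
  "degree_matrix E = (\<chi> i j. if i = j then real (card {w. (i, w) \<in> E}) else 0)"

definition laplacian :: "('v::finite) rel \<Rightarrow> real^'v^'v" where
  "laplacian E = degree_matrix E - adjacency_matrix E"

definition is_group_inverse :: "real^'n^'n \<Rightarrow> real^'n^'n \<Rightarrow> bool" where
  "is_group_inverse A X \<longleftrightarrow> A ** X ** A = A \<and> X ** A ** X = X \<and> A ** X = X ** A"

lemma is_group_inverse_unique:
  assumes "is_group_inverse A X" and "is_group_inverse A Y"
  shows "X = Y"
proof -
  have X: "A ** X ** A = A" "X ** A ** X = X" "A ** X = X ** A"
    and Y: "A ** Y ** A = A" "Y ** A ** Y = Y" "A ** Y = Y ** A"
    using assms by (auto simp: is_group_inverse_def)
  have "A ** X = A ** Y ** A ** X" by (simp add: Y(1))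
  also have "\<dots> = Y ** (A ** (A ** X))" by (simp add: Y(3) matrix_mul_assoc)
  also have "\<dots> = Y ** (A ** X ** A)" by (simp add: X(3) matrix_mul_assoc)
  also have "\<dots> = A ** Y" by (simp add: X(1) Y(3))
  finally have AX: "A ** X = A ** Y" .
  have "X = X ** (A ** X)" by (simp add: X(2) matrix_mul_assoc)
  also have "\<dots> = (A ** X) ** Y" by (simp add: AX X(3)[symmetric] matrix_mul_assoc)
  also have "\<dots> = Y" by (simp add: AX Y(2,3))
  finally show ?thesis .
qed

definition group_inverse :: "real^'n^'n \<Rightarrow> real^'n^'n" where
  "group_inverse A = (THE X. is_group_inverse A X)"

definition resistance_distance :: "('v::finite) rel \<Rightarrow> 'v \<Rightarrow> 'v \<Rightarrow> real" where
  "resistance_distance E i j =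
     (let M = group_inverse (laplacian E) in M $ i $ i + M $ j $ j - 2 * M $ i $ j)"

definition complete_graph :: "'v set \<Rightarrow> 'v rel" where
  "complete_graph C = {(u, v). u \<in> C \<and> v \<in> C \<and> u \<noteq> v}"

definition complete_bipartite :: "'v set \<Rightarrow> 'v set \<Rightarrow> 'v rel" where
  "complete_bipartite P Q = P \<times> Q \<union> Q \<times> P"

text \<open>
  Identifying the vertex \<open>a\<close> of one graph with a vertex of another, disjoint graph gives the
  union of the two edge relations after the second graph has been relabelled so that \<open>a\<close> is
  the only vertex common to both. Here the second graph is the complete graph on a set \<open>C\<close>,
  to be used with \<open>a \<in> P\<close>, \<open>P \<inter> Q = {}\<close>, \<open>C \<inter> (P \<union> Q) = {a}\<close> and \<open>P \<union> Q \<union> C = UNIV\<close>.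
\<close>

definition complete_bipartite_glue_complete :: "'v set \<Rightarrow> 'v set \<Rightarrow> 'v set \<Rightarrow> 'v rel" where
  "complete_bipartite_glue_complete P Q C = complete_bipartite P Q \<union> complete_graph C"

end

theory Submission
  imports Defs
begin

text \<open>
  For a symmetric matrix \<open>L\<close> with group inverse \<open>M\<close> and a vector \<open>v\<close> with \<open>L v = e\<^sub>i - e\<^sub>j\<close>, the
  identity \<open>L M L = L\<close> gives \<open>(e\<^sub>i - e\<^sub>j) \<bullet> M (e\<^sub>i - e\<^sub>j) = v \<bullet> L v = v\<^sub>i - v\<^sub>j\<close>. Hence a resistance
  distance is the potential drop of any potential carrying a unit current from \<open>i\<close> to \<open>j\<close>.
  Such potentials are explicit on complete and complete bipartite graphs. A potential on one of
  two graphs sharing a single vertex extends by a constant to the other, so resistances inside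
  either graph are unchanged and resistances across the common vertex add up.
\<close>

section \<open>Group inverses of symmetric matrices\<close>

lemma inner_symmetric_matrix:
  fixes A :: "real^'n^'n"
  assumes "transpose A = A"
  shows "(A *v x) \<bullet> y = x \<bullet> (A *v y)"
  using dot_lmul_matrix[of x A y] vector_transpose_matrix[of x A] by (simp add: assms)

lemma is_group_inverse_transpose:
  assumes "is_group_inverse A X"
  shows "is_group_inverse (transpose A) (transpose X)"
proof -
  have X: "A ** (X ** A) = A" "X ** (A ** X) = X" "A ** X = X ** A"
    using assms unfolding is_group_inverse_def matrix_mul_assoc by blast+
  show ?thesis
    unfolding is_group_inverse_def matrix_transpose_mul[symmetric] X(1,2) by (simp only: X(3) simp_thms)
qed

text \<open>The kernel of a symmetric \<open>A\<close> is orthogonal to its range, so \<open>A\<close> and \<open>A\<^sup>2\<close> have the same range.\<close>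

lemma symmetric_matrix_factor_square:
  fixes A :: "real^'n^'n"
  assumes sym: "transpose A = A"
  obtains Y where "A = A ** A ** Y"
proof -
  have "\<exists>w. A *v x = A *v (A *v w)" for x
  proof -
    obtain u k where u: "u \<in> span (range ((*v) A))"
      and k: "\<And>w. w \<in> span (range ((*v) A)) \<Longrightarrow> orthogonal k w" and x: "x = u + k"
      using orthogonal_subspace_decomp_exists by blast
    have "subspace (range ((*v) A))"
      by (simp add: linear_subspace_image)
    with u obtain w where w: "u = A *v w"
      by (auto simp: span_eq_iff[THEN iffD2])
    \<comment> \<open>\<open>k\<close> is orthogonal to the range, which contains
      \<open>A *v (A *v k)\<close>. So \<open>A *v k\<close> has norm zero and
      \<open>A *v x = A *v u\<close>.\<close>
    have "(A *v k) \<bullet> (A *v k) = k \<bullet> (A *v (A *v k))"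
      by (rule inner_symmetric_matrix[OF sym])
    also have "\<dots> = 0"
      using k[of "A *v (A *v k)"] by (simp add: span_base orthogonal_def)
    finally show ?thesis
      by (auto simp: x w matrix_vector_right_distrib)
  qed
  then obtain w where w: "\<And>x. A *v x = A *v (A *v w x)"
    by metis
  \<comment> \<open>Column \<open>j\<close> of \<open>Y\<close> is the chosen solution for the basis
    vector \<open>axis j 1\<close>; the two sides need only be compared on such vectors.\<close>
  define Y :: "real^'n^'n" where "Y = (\<chi> i j. w (axis j 1) $ i)"
  have "A *v axis j 1 = (A ** A ** Y) *v axis j 1" for j
  proof -
    have "Y *v axis j 1 = w (axis j 1)"
      by (simp add: Y_def vec_eq_iff matrix_vector_mul_component inner_axis)
    then show ?thesis
      by (simp only: matrix_vector_mul_assoc[symmetric] w[symmetric])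
  qed
  then have "A = A ** A ** Y"
    by (simp add: vec_eq_iff matrix_vector_mul_component inner_axis)
  then show thesis
    by (rule that)
qed

text \<open>From \<open>A = A^2 Y\<close> and its transpose \<open>A = Z A^2\<close> follows
  \<open>Z A = Z A^2 Y = A Y\<close>. Moving between these two forms shows that
  \<open>X = A Y^2\<close> satisfies \<open>A X = A Y = X A\<close>, and then
  \<open>A X A = A\<close> and \<open>X A X = X\<close>.\<close>

lemma is_group_inverse_symmetric_exists:
  fixes A :: "real^'n^'n"
  assumes sym: "transpose A = A"
  shows "\<exists>X. is_group_inverse A X"
proof -
  obtain Y where "A = A ** A ** Y"
    using symmetric_matrix_factor_square[OF sym] .
  then have Y: "A ** A ** Y = A" ..
  define Z where "Z = transpose Y"
  have Z: "Z ** A ** A = A"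
    using arg_cong[OF Y, of transpose] by (simp add: matrix_transpose_mul sym Z_def matrix_mul_assoc)
  have "Z ** A = Z ** (A ** A ** Y)"
    by (simp only: Y)
  then have ZA: "Z ** A = A ** Y"
    by (simp only: matrix_mul_assoc Z)
  have AX: "A ** (A ** Y ** Y) = A ** Y"
    by (simp only: matrix_mul_assoc Y)
  have "(A ** Y ** Y) ** A = Z ** (A ** Y) ** A"
    by (simp only: matrix_mul_assoc ZA)
  also have "\<dots> = Z ** (Z ** A ** A)"
    by (simp only: ZA[symmetric] matrix_mul_assoc)
  finally have XA: "(A ** Y ** Y) ** A = A ** Y"
    unfolding Z unfolding ZA .
  have AXA: "A ** Y ** A = A"
    by (simp only: ZA[symmetric] Z)
  have "A ** Y ** (A ** Y ** Y) = Z ** A ** A ** Y ** Y"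
    by (simp only: ZA matrix_mul_assoc)
  then have XAX: "A ** Y ** (A ** Y ** Y) = A ** Y ** Y"
    by (simp only: Z)
  have "is_group_inverse A (A ** Y ** Y)"
    unfolding is_group_inverse_def XA AX by (simp only: AXA XAX simp_thms)
  then show ?thesis ..
qed

text \<open>Uniqueness makes the description in \<open>group_inverse\<close> denote the matrix just
  constructed. It also gives symmetry, since the transpose is a group inverse of the same
  matrix.\<close>

lemma
  fixes A :: "real^'n^'n"
  assumes sym: "transpose A = A"
  shows is_group_inverse_group_inverse: "is_group_inverse A (group_inverse A)"
    and transpose_group_inverse: "transpose (group_inverse A) = group_inverse A"
proof -
  obtain X where X: "is_group_inverse A X"
    using is_group_inverse_symmetric_exists[OF sym] ..
  show *: "is_group_inverse A (group_inverse A)"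
    unfolding group_inverse_def by (rule theI, rule X, rule is_group_inverse_unique[OF _ X])
  show "transpose (group_inverse A) = group_inverse A"
    using is_group_inverse_transpose[OF *] by (intro is_group_inverse_unique[OF _ *]) (simp add: sym)
qed

section \<open>Potentials and resistance distance\<close>

lemma laplacian_mult_vector:
  "(laplacian E *v v) $ k = (\<Sum>w\<in>E `` {k}. v $ k - v $ w)"
proof -
  have Image: "{w. (k, w) \<in> E} = E `` {k}"
    by auto
  have "laplacian E $ k $ j * v $ j
      = (if k = j then real (card (E `` {k})) * v $ j else 0)
        - (if j \<in> E `` {k} then v $ j else 0)" for j
    unfolding Image[symmetric]
    by (simp add: laplacian_def degree_matrix_def adjacency_matrix_def left_diff_distrib)
  then have "(laplacian E *v v) $ k
      = (\<Sum>j\<in>UNIV. (if k = j then real (card (E `` {k})) * v $ j else 0))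
        - (\<Sum>j\<in>UNIV. if j \<in> E `` {k} then v $ j else 0)"
    by (simp only: matrix_vector_mult_def vec_lambda_beta sum_subtractf)
  also have "\<dots> = (\<Sum>w\<in>E `` {k}. v $ k - v $ w)"
    by (simp add: sum_subtractf sum.If_cases Image)
  finally show ?thesis .
qed

lemma transpose_laplacian:
  assumes "sym E"
  shows "transpose (laplacian E) = laplacian E"
  using assms by (auto simp: laplacian_def degree_matrix_def adjacency_matrix_def transpose_def
      vec_eq_iff dest: symD)

text \<open>Kirchhoff's current law: by \<open>laplacian_mult_vector\<close> this is
  \<open>L f = e_i - e_j\<close> read entrywise. Sums over neighbours split directly along a union
  of edge sets.\<close>

definition unit_potential :: "('v::finite) rel \<Rightarrow> 'v \<Rightarrow> 'v \<Rightarrow> ('v \<Rightarrow> real) \<Rightarrow> bool" where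
  "unit_potential E i j f \<longleftrightarrow>
     (\<forall>k. (\<Sum>w\<in>E `` {k}. f k - f w) = of_bool (k = i) - of_bool (k = j))"

lemma unit_potentialD:
  "unit_potential E i j f \<Longrightarrow> (\<Sum>w\<in>E `` {k}. f k - f w) = of_bool (k = i) - of_bool (k = j)"
  by (simp add: unit_potential_def)

text \<open>A relation, so that one exhibited potential is a full witness; for symmetric
  \<open>E\<close>, \<open>resistance_distance_eqI\<close> shows that it determines
  \<open>r\<close>.\<close>

definition effective_resistance :: "('v::finite) rel \<Rightarrow> 'v \<Rightarrow> 'v \<Rightarrow> real \<Rightarrow> bool" where
  "effective_resistance E i j r \<longleftrightarrow> (\<exists>f. unit_potential E i j f \<and> f i - f j = r)"

lemma resistance_distance_eqI:
  assumes sym: "sym E" and r: "effective_resistance E i j r"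
  shows "resistance_distance E i j = r"
proof -
  obtain f where f: "unit_potential E i j f" "f i - f j = r"
    using r by (auto simp: effective_resistance_def)
  define v :: "real^'a" where "v = (\<chi> k. f k)"
  define L where "L = laplacian E"
  define M where "M = group_inverse L"
  define e :: "real^'a" where "e = axis i 1 - axis j 1"
  have trL: "transpose L = L"
    by (simp add: L_def transpose_laplacian sym)
  have LML: "L ** M ** L = L"
    using is_group_inverse_group_inverse[OF trL] unfolding M_def is_group_inverse_def by blast
  have Mji: "M $ j $ i = M $ i $ j"
    using transpose_group_inverse[OF trL] by (metis M_def transpose_def vec_lambda_beta)
  have Lv: "L *v v = e"
    by (auto simp: L_def vec_eq_iff laplacian_mult_vector v_def unit_potentialD[OF f(1)] e_def axis_def)
  \<comment> \<open>The quadratic form expands to four entries of \<open>M\<close>; symmetry of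
    \<open>M\<close> merges the two mixed ones.\<close>
  have "resistance_distance E i j = e \<bullet> (M *v e)"
    by (simp add: resistance_distance_def Let_def flip: L_def M_def)
      (simp add: e_def Mji inner_diff_left inner_axis' matrix_vector_mul_component
        inner_diff_right inner_axis)
  also have "\<dots> = (L *v v) \<bullet> (M *v (L *v v))"
    by (simp add: Lv)
  also have "\<dots> = v \<bullet> ((L ** M ** L) *v v)"
    by (simp add: inner_symmetric_matrix[OF trL] matrix_vector_mul_assoc matrix_mul_assoc)
  also have "\<dots> = v \<bullet> e"
    by (simp add: LML Lv)
  also have "\<dots> = r"
    by (simp add: e_def v_def inner_diff_right inner_axis f(2))
  finally show ?thesis .
qed

section \<open>Two graphs sharing one vertex\<close>

lemma unit_potential_extend:
  assumes E1: "E1 \<subseteq> V1 \<times> V1" "irrefl E1" and E2: "E2 \<subseteq> V2 \<times> V2"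
    and V: "V1 \<inter> V2 = {a}" and ij: "i \<in> V1" "j \<in> V1"
    and f: "unit_potential E1 i j f"
  shows "unit_potential (E1 \<union> E2) i j (\<lambda>k. if k \<in> V2 then f a else f k)"
  unfolding unit_potential_def
proof
  fix k
  let ?g = "\<lambda>k. if k \<in> V2 then f a else f k"
  have g: "?g k = f k" if "k \<in> V1" for k
    using that V by auto
  \<comment> \<open>A common edge would have both ends in \<open>V1 \<inter> V2 = {a}\<close>, hence
    be a loop.\<close>
  have disj: "E1 `` {k} \<inter> E2 `` {k} = {}"
  proof -
    have False if "(k, w) \<in> E1" "(k, w) \<in> E2" for w
    proof -
      have "k \<in> V1 \<inter> V2" "w \<in> V1 \<inter> V2"
        using that E1 E2 by auto
      then show False
        using that E1(2) by (auto simp: V irrefl_def)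
    qed
    then show ?thesis by blast
  qed
  have "(\<Sum>w\<in>(E1 \<union> E2) `` {k}. ?g k - ?g w)
      = (\<Sum>w\<in>E1 `` {k}. ?g k - ?g w) + (\<Sum>w\<in>E2 `` {k}. ?g k - ?g w)"
    by (simp only: Un_Image sum.union_disjoint[OF _ _ disj] finite)
  \<comment> \<open>Both ends of an edge of \<open>E2\<close> lie in \<open>V2\<close>, where the
    potential is constantly \<open>f a\<close>, so the edge carries no current.\<close>
  also have "(\<Sum>w\<in>E2 `` {k}. ?g k - ?g w) = 0"
    using E2 by (intro sum.neutral) auto
  also have "(\<Sum>w\<in>E1 `` {k}. ?g k - ?g w) = (\<Sum>w\<in>E1 `` {k}. f k - f w)"
    using E1 by (intro sum.cong refl arg_cong2[where f = "(-)"] g) auto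
  finally show "(\<Sum>w\<in>(E1 \<union> E2) `` {k}. ?g k - ?g w) = of_bool (k = i) - of_bool (k = j)"
    by (simp add: unit_potentialD[OF f])
qed

lemma effective_resistance_extend:
  assumes "E1 \<subseteq> V1 \<times> V1" "irrefl E1" "E2 \<subseteq> V2 \<times> V2"
    and V: "V1 \<inter> V2 = {a}" and ij: "i \<in> V1" "j \<in> V1"
    and "effective_resistance E1 i j r"
  shows "effective_resistance (E1 \<union> E2) i j r"
proof -
  obtain f where f: "unit_potential E1 i j f" "f i - f j = r"
    using assms by (auto simp: effective_resistance_def)
  define g where "g = (\<lambda>k. if k \<in> V2 then f a else f k)"
  have "unit_potential (E1 \<union> E2) i j g"
    unfolding g_def by (rule unit_potential_extend[OF assms(1-6) f(1)])
  moreover have "g k = f k" if "k \<in> V1" for k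
    using that V by (auto simp: g_def)
  then have "g i - g j = r"
    using ij f(2) by simp
  ultimately show ?thesis
    unfolding effective_resistance_def by blast
qed

lemma effective_resistance_series:
  assumes E1: "E1 \<subseteq> V1 \<times> V1" "irrefl E1" and E2: "E2 \<subseteq> V2 \<times> V2" "irrefl E2"
    and V: "V1 \<inter> V2 = {a}" and ij: "i \<in> V1" "j \<in> V2"
    and r: "effective_resistance E1 i a r" and s: "effective_resistance E2 a j s"
  shows "effective_resistance (E1 \<union> E2) i j (r + s)"
proof -
  obtain f where f: "unit_potential E1 i a f" "f i - f a = r"
    using r by (auto simp: effective_resistance_def)
  obtain g where g: "unit_potential E2 a j g" "g a - g j = s"
    using s by (auto simp: effective_resistance_def)
  define f' where "f' = (\<lambda>k. if k \<in> V2 then f a else f k)"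
  define g' where "g' = (\<lambda>k. if k \<in> V1 then g a else g k)"
  have a: "a \<in> V1" "a \<in> V2" and V': "V2 \<inter> V1 = {a}"
    using V by auto
  have f': "unit_potential (E1 \<union> E2) i a f'"
    unfolding f'_def by (rule unit_potential_extend[OF E1 E2(1) V ij(1) a(1) f(1)])
  have g': "unit_potential (E1 \<union> E2) a j g'"
    unfolding g'_def using unit_potential_extend[OF E2 E1(1) V' a(2) ij(2) g(1)]
    by (simp add: Un_commute)
  \<comment> \<open>Superposition: the unit current that \<open>f'\<close> takes out at
    \<open>a\<close> is the one that \<open>g'\<close> feeds in there.\<close>
  have "unit_potential (E1 \<union> E2) i j (\<lambda>k. f' k + g' k)"
    unfolding unit_potential_def
    using f' g' by (simp add: unit_potential_def add_diff_add sum.distrib)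
  moreover have "f' i = f i" "g' j = g j"
    using ij V by (auto simp: f'_def g'_def)
  \<comment> \<open>Each extension is constant on the other side: \<open>f' j = f a\<close> and
    \<open>g' i = g a\<close>.\<close>
  then have "(f' i + g' i) - (f' j + g' j) = r + s"
    using ij f(2) g(2) by (simp add: f'_def g'_def)
  ultimately show ?thesis
    unfolding effective_resistance_def by blast
qed

section \<open>Explicit potentials on complete and complete bipartite graphs\<close>

lemma effective_resistance_complete_graph:
  assumes "i \<in> C" "j \<in> C" "i \<noteq> j"
  shows "effective_resistance (complete_graph C) i j (2 / card C)"
proof -
  \<comment> \<open>The values sum to zero over \<open>C\<close>, so the current out of
    \<open>k\<close> in \<open>C\<close> is \<open>card C\<close> times its potential. Including
    \<open>k\<close> among its own neighbours adds a zero term.\<close>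
  let ?f = "\<lambda>k. (of_bool (k = i) - of_bool (k = j)) / real (card C)"
  have C: "card C > 0"
    using assms by (auto simp: card_gt_0_iff)
  have "unit_potential (complete_graph C) i j ?f"
    unfolding unit_potential_def
  proof
    fix k
    have eq: "(\<Sum>w\<in>C. of_bool (w = u)) = (1::real)" if "u \<in> C" for u
      using that by (simp add: of_bool_def)
    show "(\<Sum>w\<in>complete_graph C `` {k}. ?f k - ?f w) = of_bool (k = i) - of_bool (k = j)"
    proof (cases "k \<in> C")
      case True
      have "complete_graph C `` {k} = C - {k}"
        using True by (auto simp: complete_graph_def)
      then have "(\<Sum>w\<in>complete_graph C `` {k}. ?f k - ?f w) = (\<Sum>w\<in>C. ?f k - ?f w)"
        using True by (simp add: sum.remove[of C k])
      also have "\<dots> = of_bool (k = i) - of_bool (k = j)"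
        using C by (simp only: sum_subtractf sum_divide_distrib[symmetric] eq assms sum_constant)
          (simp add: card_gt_0_iff)
      finally show ?thesis .
    next
      case False
      then have "complete_graph C `` {k} = {}"
        by (auto simp: complete_graph_def)
      with False assms show ?thesis by auto
    qed
  qed
  moreover have "?f i - ?f j = 2 / card C"
    using assms by simp
  ultimately show ?thesis
    unfolding effective_resistance_def by blast
qed

lemma complete_bipartite_Image:
  assumes "P \<inter> Q = {}"
  shows "complete_bipartite P Q `` {k} = (if k \<in> P then Q else if k \<in> Q then P else {})"
  using assms by (auto simp: complete_bipartite_def)

lemma complete_bipartite_commute: "complete_bipartite P Q = complete_bipartite Q P"
  by (auto simp: complete_bipartite_def)

lemma effective_resistance_complete_bipartite_same:
  fixes P Q :: "('v::finite) set"
  assumes PQ: "P \<inter> Q = {}" "Q \<noteq> {}" and ij: "i \<in> P" "j \<in> P" "i \<noteq> j"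
  shows "effective_resistance (complete_bipartite P Q) i j (2 / card Q)"
proof -
  \<comment> \<open>The potential vanishes on \<open>Q\<close> and sums to zero over
    \<open>P\<close>: the current out of \<open>k\<close> is \<open>card Q\<close> times its
    potential if \<open>k\<close> is in \<open>P\<close>, and zero if \<open>k\<close> is in
    \<open>Q\<close>.\<close>
  let ?f = "\<lambda>k. (of_bool (k = i) - of_bool (k = j)) / real (card Q)"
  have q: "real (card Q) \<noteq> 0"
    using PQ by simp
  have out: "i \<notin> Q" "j \<notin> Q"
    using PQ ij by auto
  have eq: "(\<Sum>w\<in>P. of_bool (w = u)) = (1::real)" if "u \<in> P" for u
    using that by (simp add: of_bool_def)
  have eq0: "(\<Sum>w\<in>Q. of_bool (w = u)) = (0::real)" if "u \<notin> Q" for u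
    using that by (intro sum.neutral) auto
  have "unit_potential (complete_bipartite P Q) i j ?f"
    unfolding unit_potential_def
  proof
    fix k
    consider "k \<in> P" "k \<notin> Q" | "k \<in> Q" "k \<notin> P" | "k \<notin> P" "k \<notin> Q"
      using PQ by blast
    then show "(\<Sum>w\<in>complete_bipartite P Q `` {k}. ?f k - ?f w) = of_bool (k = i) - of_bool (k = j)"
    proof cases
      case 1
      then show ?thesis
        using q by (simp add: complete_bipartite_Image PQ sum_subtractf
            sum_divide_distrib[symmetric] eq0 out)
    next
      case 2
      then have "k \<noteq> i" "k \<noteq> j"
        using ij by auto
      with 2 show ?thesis
        by (simp add: complete_bipartite_Image PQ sum_subtractf sum_negf
            sum_divide_distrib[symmetric] eq ij del: sum_of_bool_eq)
    next
      case 3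
      with ij show ?thesis
        by (auto simp: complete_bipartite_Image PQ)
    qed
  qed
  moreover have "?f i - ?f j = 2 / card Q"
    using ij by simp
  ultimately show ?thesis
    unfolding effective_resistance_def by blast
qed

lemma effective_resistance_complete_bipartite_cross:
  fixes P Q :: "('v::finite) set"
  assumes PQ: "P \<inter> Q = {}" and ij: "i \<in> P" "j \<in> Q"
  shows "effective_resistance (complete_bipartite P Q) i j
    ((real (card P) + real (card Q) - 1) / (real (card P) * real (card Q)))"
proof -
  let ?p = "real (card P)" and ?q = "real (card Q)"
  \<comment> \<open>The shift by \<open>1 / (p q)\<close> on \<open>P\<close> makes the sum over
    \<open>P\<close> vanish, so vertices of \<open>Q\<close> see only the term at \<open>j\<close>.
    At \<open>k\<close> in \<open>P\<close> the shift contributes \<open>- 1 / p\<close>, cancelled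
    by the sum \<open>- 1 / p\<close> over \<open>Q\<close>.\<close>
  define f :: "'v \<Rightarrow> real" where
    "f = (\<lambda>k. of_bool (k = i) / ?q - of_bool (k = j) / ?p - of_bool (k \<in> P) / (?p * ?q))"
  have pq: "?p \<noteq> 0" "?q \<noteq> 0"
    using ij by auto
  have out: "i \<notin> Q" "j \<notin> P" "i \<noteq> j"
    using PQ ij by auto
  have fP: "(\<Sum>w\<in>P. f w) = 0"
  proof -
    have "(\<Sum>w\<in>P. f w) = (\<Sum>w\<in>P. (if w = i then 1 / ?q else 0) - 1 / (?p * ?q))"
      using out by (intro sum.cong) (auto simp: f_def)
    also have "\<dots> = 0"
      using pq ij by (simp add: sum_subtractf)
    finally show ?thesis .
  qed
  have fQ: "(\<Sum>w\<in>Q. f w) = - 1 / ?p"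
  proof -
    have "(\<Sum>w\<in>Q. f w) = (\<Sum>w\<in>Q. if w = j then - 1 / ?p else 0)"
      using out PQ by (intro sum.cong) (auto simp: f_def)
    also have "\<dots> = - 1 / ?p"
      using ij by simp
    finally show ?thesis .
  qed
  have diff: "(\<Sum>w\<in>S. f k - f w) = real (card S) * f k - (\<Sum>w\<in>S. f w)" for S k
    by (simp add: sum_subtractf)
  have "unit_potential (complete_bipartite P Q) i j f"
    unfolding unit_potential_def
  proof
    fix k
    consider "k \<in> P" "k \<notin> Q" | "k \<in> Q" "k \<notin> P" | "k \<notin> P" "k \<notin> Q"
      using PQ by blast
    then show "(\<Sum>w\<in>complete_bipartite P Q `` {k}. f k - f w) = of_bool (k = i) - of_bool (k = j)"
    proof cases
      case 1
      then have "(\<Sum>w\<in>complete_bipartite P Q `` {k}. f k - f w) = ?q * f k + 1 / ?p"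
        by (simp add: complete_bipartite_Image PQ diff fQ)
      with 1 ij out pq show ?thesis
        by (auto simp: f_def field_simps)
    next
      case 2
      then have "(\<Sum>w\<in>complete_bipartite P Q `` {k}. f k - f w) = ?p * f k"
        by (simp add: complete_bipartite_Image PQ diff fP)
      with 2 ij out pq show ?thesis
        by (auto simp: f_def)
    next
      case 3
      with ij show ?thesis
        by (auto simp: complete_bipartite_Image PQ)
    qed
  qed
  moreover have "f i - f j = (?p + ?q - 1) / (?p * ?q)"
    using ij out pq by (simp add: f_def field_simps)
  ultimately show ?thesis
    unfolding effective_resistance_def by blast
qed

section \<open>Resistances in the glued graph\<close>

theorem theorem3p5:
  fixes P Q C N :: "('v::finite) set" and a :: 'v and E :: "'v rel" and p q n :: nat
  assumes "p \<ge> 1" and "q \<ge> 1" and "n \<ge> 2"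
    and "card P = p" and "card Q = q" and "P \<inter> Q = {}" and "a \<in> P"
    and "card C = n" and "C \<inter> (P \<union> Q) = {a}" and "N = C - {a}"
    and "P \<union> Q \<union> C = UNIV"
    and "E = complete_bipartite_glue_complete P Q C"
  shows
    "(\<forall>x \<in> P - {a}. resistance_distance E a x = 2 / real q) \<and>
     (\<forall>y \<in> Q. resistance_distance E a y = (real p + real q - 1) / (real p * real q)) \<and>
     (\<forall>z \<in> N. resistance_distance E a z = 2 / real n) \<and>
     (\<forall>x \<in> P - {a}. \<forall>x' \<in> P - {a}. x \<noteq> x' \<longrightarrow> resistance_distance E x x' = 2 / real q) \<and>
     (\<forall>x \<in> P - {a}. \<forall>y \<in> Q.
        resistance_distance E x y = (real p + real q - 1) / (real p * real q)) \<and>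
     (\<forall>x \<in> P - {a}. \<forall>z \<in> N.
        resistance_distance E x z = 2 * (real q + real n) / (real q * real n)) \<and>
     (\<forall>y \<in> Q. \<forall>y' \<in> Q. y \<noteq> y' \<longrightarrow> resistance_distance E y y' = 2 / real p) \<and>
     (\<forall>y \<in> Q. \<forall>z \<in> N. resistance_distance E y z =
        (real q * (real n + 2 * real p) + real n * (real p - 1)) / (real n * real p * real q)) \<and>
     (\<forall>z \<in> N. \<forall>z' \<in> N. z \<noteq> z' \<longrightarrow> resistance_distance E z z' = 2 / real n)"
proof -
  define B where "B = complete_bipartite P Q"
  define K where "K = complete_graph C"
  \<comment> \<open>Both orders are recorded because the extension lemma treats its first graph as
    the one carrying the current.\<close>
  have E: "E = B \<union> K" "E = K \<union> B"
    using assms by (auto simp: B_def K_def complete_bipartite_glue_complete_def)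
  have sym: "sym E"
    by (auto simp: E B_def K_def complete_bipartite_def complete_graph_def sym_def)
  have V: "(P \<union> Q) \<inter> C = {a}" "C \<inter> (P \<union> Q) = {a}"
    using assms by auto
  have B: "B \<subseteq> (P \<union> Q) \<times> (P \<union> Q)" "irrefl B"
    using assms by (auto simp: B_def complete_bipartite_def irrefl_def)
  have K: "K \<subseteq> C \<times> C" "irrefl K"
    by (auto simp: K_def complete_graph_def irrefl_def)
  have PQ: "P \<inter> Q = {}" "Q \<inter> P = {}" "P \<noteq> {}" "Q \<noteq> {}"
    using assms by auto
  have N: "z \<in> C" "z \<noteq> a" if "z \<in> N" for z
    using assms that by auto
  note rd = resistance_distance_eqI[OF sym]
  have a: "a \<in> P" "a \<in> C"
    using V assms by auto
  \<comment> \<open>Here \<open>a\<close> is an ordinary vertex of \<open>P\<close>, so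
    \<open>BPP\<close> and \<open>BPQ\<close> also cover the pairs containing
    \<open>a\<close>.\<close>
  have BPP: "effective_resistance B x x' (2 / q)" if "x \<in> P" "x' \<in> P" "x \<noteq> x'" for x x'
    using effective_resistance_complete_bipartite_same[OF PQ(1,4) that] assms by (simp add: B_def)
  have BQQ: "effective_resistance B y y' (2 / p)" if "y \<in> Q" "y' \<in> Q" "y \<noteq> y'" for y y'
    using effective_resistance_complete_bipartite_same[OF PQ(2,3) that] assms
    by (simp add: B_def complete_bipartite_commute)
  have BPQ: "effective_resistance B x y ((real p + real q - 1) / (real p * real q))"
    if "x \<in> P" "y \<in> Q" for x y
    using effective_resistance_complete_bipartite_cross[OF PQ(1) that] assms by (simp add: B_def)
  \<comment> \<open>This orientation is wanted for the pairs in \<open>Q\<close> and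
    \<open>N\<close>, where the first leg runs from \<open>y\<close> to \<open>a\<close>.\<close>
  have BQP: "effective_resistance B y x ((real p + real q - 1) / (real p * real q))"
    if "x \<in> P" "y \<in> Q" for x y
    using effective_resistance_complete_bipartite_cross[OF PQ(2) that(2,1)] assms
    by (simp add: B_def complete_bipartite_commute add.commute mult.commute)
  have KC: "effective_resistance K z z' (2 / n)" if "z \<in> C" "z' \<in> C" "z \<noteq> z'" for z z'
    using effective_resistance_complete_graph[OF that] assms by (simp add: K_def)
  have rB: "resistance_distance E i j = r"
    if "i \<in> P \<union> Q" "j \<in> P \<union> Q" "effective_resistance B i j r" for i j r
    using rd effective_resistance_extend[OF B K(1) V(1) that] by (simp add: E(1))
  have rK: "resistance_distance E i j = r"
    if "i \<in> C" "j \<in> C" "effective_resistance K i j r" for i j r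
    using rd effective_resistance_extend[OF K B(1) V(2) that] by (simp add: E(2))
  \<comment> \<open>Current from \<open>i\<close> to \<open>z\<close> must pass through
    \<open>a\<close>; the second leg, inside the complete graph, costs \<open>2 / n\<close>.\<close>
  have rBK: "resistance_distance E i z = r + 2 / n"
    if "i \<in> P \<union> Q" "z \<in> N" "effective_resistance B i a r" for i z r
    using rd effective_resistance_series[OF B K V(1) that(1) N(1)[OF that(2)] that(3) KC]
      a N[OF that(2)] by (simp add: E(1))
  have pos: "real p \<noteq> 0" "real q \<noteq> 0" "real n \<noteq> 0"
    using assms by auto
  have xz: "resistance_distance E x z = 2 * (real q + real n) / (real q * real n)"
    if "x \<in> P - {a}" "z \<in> N" for x z
    using rBK[of x z "2 / q"] BPP[of x a] that a pos by (simp add: field_simps)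
  have yz: "resistance_distance E y z =
      (real q * (real n + 2 * real p) + real n * (real p - 1)) / (real n * real p * real q)"
    if "y \<in> Q" "z \<in> N" for y z
    using rBK[OF _ that(2) BQP[OF a(1) that(1)]] that pos by (simp add: field_simps)
  show ?thesis
    by (intro conjI ballI impI; (rule xz yz | rule rB[OF _ _ BPP] | rule rB[OF _ _ BQQ]
      | rule rB[OF _ _ BPQ] | rule rK[OF _ _ KC]); use a N in auto)
qed

end
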